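(* Let $G$ be a finite group containing a $2$-subgroup that is not nilpotent of class at most $2$. Then $\mathcal G(\mathcal C(G))$ does not embed in a wreath product of a finite group with a torsion-free group.
   Context: The Cayley machine $\mathcal C(G)$ of a finite group $G$ is the Mealy automaton with state set and alphabet $G$ which, in state $g$ on input $a$, outputs $ga$ and moves to state $ga$. State $g$ computes the bijection $\mathcal C(G)_g(a_0,a_1,\dots,a_m)=(ga_0,ga_0a_1,\dots,ga_0a_1\cdots a_m)$ of the set $G^*$ of words over $G$. $\mathcal G(\mathcal C(G))$ is the group of bijections of $G^*$ generated by the $\mathcal C(G)_g$, $g\in G$. The wreath product of $K$ with $H$ means the restricted wreath product $K\,\mathrm{wr}\,H=\left(\bigoplus_HK\right)\rtimes H$, with $H$ acting by translation of coordinates. *)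

theory Defs
  imports "HOL-Algebra.Bij" "HOL-Algebra.Product_Groups"
begin

section \<open>Mealy automata and the groups they generate\<close>

record ('s, 'a) mealy =
  mealy_states :: "'s set"
  mealy_alphabet :: "'a set"
  mealy_next :: "'s \<Rightarrow> 'a \<Rightarrow> 's"
  mealy_out :: "'s \<Rightarrow> 'a \<Rightarrow> 'a"

primrec mealy_run :: "('s, 'a) mealy \<Rightarrow> 's \<Rightarrow> 'a list \<Rightarrow> 'a list" where
  "mealy_run M q [] = []"
| "mealy_run M q (a # w) = mealy_out M q a # mealy_run M (mealy_next M q a) w"

definition mealy_function :: "('s, 'a) mealy \<Rightarrow> 's \<Rightarrow> 'a list \<Rightarrow> 'a list" where
  "mealy_function M q = restrict (mealy_run M q) (lists (mealy_alphabet M))"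

text \<open>
  This is meant for automata all of whose states compute bijections: the library's
  \<^const>\<open>subgroup_generated\<close> silently discards generators outside the ambient group.
  For the Cayley machine none is discarded, see \<open>mealy_function_cayley_machine_Bij\<close> below.
\<close>

definition automaton_group :: "('s, 'a) mealy \<Rightarrow> ('a list \<Rightarrow> 'a list) monoid" where
  "automaton_group M =
     subgroup_generated (BijGroup (lists (mealy_alphabet M)))
       (mealy_function M ` mealy_states M)"

definition cayley_machine :: "('a, 'b) monoid_scheme \<Rightarrow> ('a, 'a) mealy" where
  "cayley_machine G =
     \<lparr>mealy_states = carrier G, mealy_alphabet = carrier G,
      mealy_next = (\<lambda>g a. g \<otimes>\<^bsub>G\<^esub> a), mealy_out = (\<lambda>g a. g \<otimes>\<^bsub>G\<^esub> a)\<rparr>"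

lemma mealy_run_cayley_machine:
  "mealy_run (cayley_machine G) g w =
     map (\<lambda>i. foldl (\<otimes>\<^bsub>G\<^esub>) g (take (Suc i) w)) [0..<length w]"
proof (induction w arbitrary: g)
  case (Cons a w)
  then show ?case
    by (simp add: cayley_machine_def upt_conv_Cons map_Suc_upt[symmetric] comp_def
        del: upt_Suc)
qed simp

lemma (in group) mealy_function_cayley_machine_Bij:
  assumes "g \<in> carrier G"
  shows "mealy_function (cayley_machine G) g \<in> Bij (lists (carrier G))"
proof -
  let ?r = "mealy_run (cayley_machine G)"
  have step: "?r g (a # w) = (g \<otimes> a) # ?r (g \<otimes> a) w" for g a w
    by (simp add: cayley_machine_def)
  have closed: "?r g w \<in> lists (carrier G)"
    if "w \<in> lists (carrier G)" "g \<in> carrier G" for g w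
    using that
  proof (induction w arbitrary: g rule: list.induct)
    case (Cons a w)
    then show ?case by (simp only: step) auto
  qed simp
  have ex1: "\<exists>w\<in>lists (carrier G). ?r g w = v"
    if "v \<in> lists (carrier G)" "g \<in> carrier G" for g v
    using that
  proof (induction v arbitrary: g rule: list.induct)
    case Nil
    then show ?case by (intro bexI[of _ "[]"]) auto
  next
    case (Cons b v)
    then obtain w where w: "w \<in> lists (carrier G)" "?r b w = v" by auto
    have "g \<otimes> (inv g \<otimes> b) = b" using Cons.prems by (simp add: m_assoc[symmetric])
    then have "?r g ((inv g \<otimes> b) # w) = b # v" using w by (simp only: step)
    moreover have "(inv g \<otimes> b) # w \<in> lists (carrier G)" using w Cons.prems by auto
    ultimately show ?case by blast
  qed
  have inj: "w = w'"
    if "w \<in> lists (carrier G)" "w' \<in> lists (carrier G)" "g \<in> carrier G" "?r g w = ?r g w'"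
    for g w w'
    using that
  proof (induction w arbitrary: g w' rule: list.induct)
    case Nil
    then show ?case by (cases w') auto
  next
    case (Cons a w)
    then obtain b v where w': "w' = b # v" by (cases w') auto
    from Cons.prems(4) have eq: "g \<otimes> a = g \<otimes> b" "?r (g \<otimes> a) w = ?r (g \<otimes> b) v"
      unfolding w' step by auto
    then have "a = b" using Cons.prems w' by simp
    moreover have "w = v" using Cons.IH[of v "g \<otimes> a"] Cons.prems eq \<open>a = b\<close> w' by auto
    ultimately show ?case using w' by simp
  qed
  have "bij_betw (?r g) (lists (carrier G)) (lists (carrier G))"
  proof (rule bij_betw_imageI)
    show "inj_on (?r g) (lists (carrier G))"
      using inj assms by (intro inj_onI)
    show "?r g ` lists (carrier G) = lists (carrier G)"
    proof
      show "?r g ` lists (carrier G) \<subseteq> lists (carrier G)"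
        by (rule image_subsetI) (rule closed[OF _ assms])
      show "lists (carrier G) \<subseteq> ?r g ` lists (carrier G)"
        using ex1[OF _ assms] by (metis image_eqI subsetI)
    qed
  qed
  then show ?thesis
    by (auto simp: mealy_function_def Bij_def cayley_machine_def cong: bij_betw_cong)
qed

section \<open>Nilpotency class\<close>

definition commutator_subgroup ::
  "('a, 'b) monoid_scheme \<Rightarrow> 'a set \<Rightarrow> 'a set \<Rightarrow> 'a set" where
  "commutator_subgroup G A B =
     generate G {a \<otimes>\<^bsub>G\<^esub> b \<otimes>\<^bsub>G\<^esub> inv\<^bsub>G\<^esub> a \<otimes>\<^bsub>G\<^esub> inv\<^bsub>G\<^esub> b | a b. a \<in> A \<and> b \<in> B}"

text \<open>
  The index is shifted: \<open>lower_central G c\<close> is the term of the lower central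
  series usually written \<open>\<gamma>\<close> with index \<open>c + 1\<close>.
\<close>

primrec lower_central :: "('a, 'b) monoid_scheme \<Rightarrow> nat \<Rightarrow> 'a set" where
  "lower_central G 0 = carrier G"
| "lower_central G (Suc i) = commutator_subgroup G (lower_central G i) (carrier G)"

definition nilpotent_class_at_most :: "('a, 'b) monoid_scheme \<Rightarrow> nat \<Rightarrow> bool" where
  "nilpotent_class_at_most G c \<longleftrightarrow> group G \<and> lower_central G c = {\<one>\<^bsub>G\<^esub>}"

definition finite_p_subgroup :: "nat \<Rightarrow> 'a set \<Rightarrow> ('a, 'b) monoid_scheme \<Rightarrow> bool" where
  "finite_p_subgroup p P G \<longleftrightarrow> subgroup P G \<and> finite P \<and> (\<exists>n. card P = p ^ n)"

section \<open>Torsion-free groups and restricted wreath products\<close>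

definition torsion_free :: "('a, 'b) monoid_scheme \<Rightarrow> bool" where
  "torsion_free H \<longleftrightarrow>
     (\<forall>x\<in>carrier H. \<forall>n::nat. 0 < n \<longrightarrow> x [^]\<^bsub>H\<^esub> n = \<one>\<^bsub>H\<^esub> \<longrightarrow> x = \<one>\<^bsub>H\<^esub>)"

definition semidirect_product ::
  "('n, 'c) monoid_scheme \<Rightarrow> ('h, 'd) monoid_scheme \<Rightarrow> ('h \<Rightarrow> 'n \<Rightarrow> 'n) \<Rightarrow> ('n \<times> 'h) monoid" where
  "semidirect_product N H \<phi> =
     \<lparr>carrier = carrier N \<times> carrier H,
      mult = (\<lambda>(x, h) (y, k). (x \<otimes>\<^bsub>N\<^esub> \<phi> h y, h \<otimes>\<^bsub>H\<^esub> k)),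
      one = (\<one>\<^bsub>N\<^esub>, \<one>\<^bsub>H\<^esub>)\<rparr>"

definition translate :: "('h, 'd) monoid_scheme \<Rightarrow> 'h \<Rightarrow> ('h \<Rightarrow> 'k) \<Rightarrow> 'h \<Rightarrow> 'k" where
  "translate H h f = (\<lambda>x\<in>carrier H. f (inv\<^bsub>H\<^esub> h \<otimes>\<^bsub>H\<^esub> x))"

definition wreath_product ::
  "('k, 'c) monoid_scheme \<Rightarrow> ('h, 'd) monoid_scheme \<Rightarrow> (('h \<Rightarrow> 'k) \<times> 'h) monoid" where
  "wreath_product K H = semidirect_product (sum_group (carrier H) (\<lambda>_. K)) H (translate H)"

lemma group_wreath_product:
  assumes "group K" "group H"
  shows "group (wreath_product K H)"
proof -
  interpret K: group K by fact
  interpret H: group H by fact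
  let ?S = "{f \<in> carrier H \<rightarrow>\<^sub>E carrier K. finite {x \<in> carrier H. f x \<noteq> \<one>\<^bsub>K\<^esub>}}"
  let ?N = "sum_group (carrier H) (\<lambda>_. K)"
  interpret N: group ?N by (rule sum_group) (rule assms(1))
  have carr: "carrier ?N = ?S" by (rule carrier_sum_group) (rule assms(1))
  have tr: "translate H h f \<in> carrier ?N" if h: "h \<in> carrier H" and f: "f \<in> carrier ?N" for h f
  proof -
    have "{x \<in> carrier H. translate H h f x \<noteq> \<one>\<^bsub>K\<^esub>}
        \<subseteq> (\<lambda>y. h \<otimes>\<^bsub>H\<^esub> y) ` {x \<in> carrier H. f x \<noteq> \<one>\<^bsub>K\<^esub>}"
    proof
      fix x assume x: "x \<in> {x \<in> carrier H. translate H h f x \<noteq> \<one>\<^bsub>K\<^esub>}"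
      then have "x = h \<otimes>\<^bsub>H\<^esub> (inv\<^bsub>H\<^esub> h \<otimes>\<^bsub>H\<^esub> x)" using h by (simp add: H.m_assoc[symmetric])
      with x h show "x \<in> (\<lambda>y. h \<otimes>\<^bsub>H\<^esub> y) ` {x \<in> carrier H. f x \<noteq> \<one>\<^bsub>K\<^esub>}"
        by (intro image_eqI[of _ _ "inv\<^bsub>H\<^esub> h \<otimes>\<^bsub>H\<^esub> x"]) (auto simp: translate_def)
    qed
    then have "finite {x \<in> carrier H. translate H h f x \<noteq> \<one>\<^bsub>K\<^esub>}"
      using f unfolding carr by (auto intro: finite_subset)
    then show ?thesis
      using f h unfolding carr by (auto simp: translate_def PiE_def Pi_def)
  qed
  have tr_mult: "translate H h (f \<otimes>\<^bsub>?N\<^esub> g) = translate H h f \<otimes>\<^bsub>?N\<^esub> translate H h g"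
    if "h \<in> carrier H" for h f g
    using that by (auto simp: translate_def fun_eq_iff)
  have tr_comp: "translate H (h \<otimes>\<^bsub>H\<^esub> k) f = translate H h (translate H k f)"
    if "h \<in> carrier H" "k \<in> carrier H" for h k f
    using that by (auto simp: translate_def fun_eq_iff H.inv_mult_group H.m_assoc)
  have tr_one: "translate H \<one>\<^bsub>H\<^esub> f = f" if "f \<in> carrier ?N" for f
    using that unfolding carr
    by (auto simp: translate_def fun_eq_iff PiE_def extensional_def)
  show ?thesis
  proof (rule groupI)
    fix u v w
    assume "u \<in> carrier (wreath_product K H)" "v \<in> carrier (wreath_product K H)"
      "w \<in> carrier (wreath_product K H)"
    then show "u \<otimes>\<^bsub>wreath_product K H\<^esub> v \<otimes>\<^bsub>wreath_product K H\<^esub> w =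
        u \<otimes>\<^bsub>wreath_product K H\<^esub> (v \<otimes>\<^bsub>wreath_product K H\<^esub> w)"
      by (auto simp: wreath_product_def semidirect_product_def N.m_assoc H.m_assoc tr tr_comp
          tr_mult simp del: mult_sum_group)
  next
    fix u assume "u \<in> carrier (wreath_product K H)"
    then obtain f h where u: "u = (f, h)" and f: "f \<in> carrier ?N" and h: "h \<in> carrier H"
      by (auto simp: wreath_product_def semidirect_product_def)
    let ?v = "(translate H (inv\<^bsub>H\<^esub> h) (inv\<^bsub>?N\<^esub> f), inv\<^bsub>H\<^esub> h)"
    have "translate H (inv\<^bsub>H\<^esub> h) (inv\<^bsub>?N\<^esub> f) \<otimes>\<^bsub>?N\<^esub> translate H (inv\<^bsub>H\<^esub> h) f = \<one>\<^bsub>?N\<^esub>"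
    proof -
      have "translate H (inv\<^bsub>H\<^esub> h) \<one>\<^bsub>?N\<^esub> = \<one>\<^bsub>?N\<^esub>"
        using h by (auto simp: translate_def fun_eq_iff)
      then show ?thesis
        using tr_mult[of "inv\<^bsub>H\<^esub> h" "inv\<^bsub>?N\<^esub> f" f] h N.l_inv[OF f] by simp
    qed
    then have "?v \<otimes>\<^bsub>wreath_product K H\<^esub> u = \<one>\<^bsub>wreath_product K H\<^esub>"
      using h by (simp add: u wreath_product_def semidirect_product_def del: mult_sum_group one_sum_group)
    moreover have "?v \<in> carrier (wreath_product K H)"
      using tr[OF H.inv_closed[OF h] N.inv_closed[OF f]] h
      by (simp add: wreath_product_def semidirect_product_def del: inv_sum_group)
    ultimately show "\<exists>v\<in>carrier (wreath_product K H).
        v \<otimes>\<^bsub>wreath_product K H\<^esub> u = \<one>\<^bsub>wreath_product K H\<^esub>" by blast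
  qed (auto simp: wreath_product_def semidirect_product_def tr tr_one
      simp del: mult_sum_group one_sum_group)
qed

end

theory Submission
  imports Defs "HOL-Algebra.Multiplicative_Group"
begin

text \<open>
  It suffices that \<open>G\<close> is not abelian. Write \<open>x\<close> for the function of state \<open>1\<close> and \<open>L g\<close> for
  left multiplication of all letters by \<open>g\<close>, so that state \<open>g\<close> computes \<open>L g \<circ> x\<close>. Then \<open>x\<close> has
  infinite order and every \<open>L g\<close> is torsion. In a wreath product of a finite group with a
  torsion-free group \<open>H\<close>, torsion elements are finitely supported functions on \<open>H\<close>, and conjugation
  by powers of an element of infinite order moves any finite support off any other one. Hence
  an embedding would force some conjugate \<open>x\<^sup>n (L g) x\<^sup>-\<^sup>n\<close> to commute with \<open>L k\<close>. As \<open>x\<close> fixes the first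
  letter of each word, comparing the actions on first letters gives \<open>gk = kg\<close>.
\<close>

section \<open>Torsion in wreath products\<close>

lemma carrier_wreath_product:
  assumes "group K"
  shows "carrier (wreath_product K H) =
    {f \<in> carrier H \<rightarrow>\<^sub>E carrier K. finite {x \<in> carrier H. f x \<noteq> \<one>\<^bsub>K\<^esub>}} \<times> carrier H"
  unfolding wreath_product_def semidirect_product_def
  using carrier_sum_group[of "carrier H" "\<lambda>_. K"] assms by simp

lemma mult_wreath_product:
  "(f, h) \<otimes>\<^bsub>wreath_product K H\<^esub> (g, k) =
    ((\<lambda>x\<in>carrier H. f x \<otimes>\<^bsub>K\<^esub> translate H h g x), h \<otimes>\<^bsub>H\<^esub> k)"
  by (simp add: wreath_product_def semidirect_product_def)

lemma one_wreath_product: "\<one>\<^bsub>wreath_product K H\<^esub> = ((\<lambda>x\<in>carrier H. \<one>\<^bsub>K\<^esub>), \<one>\<^bsub>H\<^esub>)"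
  by (simp add: wreath_product_def semidirect_product_def)

lemma group_hom_snd_wreath_product:
  assumes "group K" "group H"
  shows "group_hom (wreath_product K H) H snd"
  unfolding group_hom_def group_hom_axioms_def hom_def
  using assms group_wreath_product[OF assms]
  by (auto simp: carrier_wreath_product mult_wreath_product)

text \<open>The projection to \<open>H\<close> is a homomorphism, so it sends torsion elements to
  torsion elements, and in \<open>H\<close> only \<one> is torsion. Thus torsion lies in the base
  group.\<close>

lemma snd_eq_one_of_torsion:
  assumes "group K" "group H" "torsion_free H"
    and "a \<in> carrier (wreath_product K H)" "0 < m" "a [^]\<^bsub>wreath_product K H\<^esub> (m::nat) = \<one>\<^bsub>wreath_product K H\<^esub>"
  shows "snd a = \<one>\<^bsub>H\<^esub>"
proof -
  interpret s: group_hom "wreath_product K H" H snd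
    by (rule group_hom_snd_wreath_product) fact+
  have "snd a [^]\<^bsub>H\<^esub> m = \<one>\<^bsub>H\<^esub>"
    using s.hom_nat_pow[of a m] assms(4,6) s.hom_one by simp
  then show ?thesis
    using assms(3,4,5) s.hom_closed unfolding torsion_free_def by blast
qed

text \<open>Translation by \<one> is trivial, so elements with trivial \<open>H\<close>-part
  multiply coordinatewise.\<close>

lemma wreath_product_base_pow:
  assumes "group K" "group H"
    and "a \<in> carrier (wreath_product K H)" "snd a = \<one>\<^bsub>H\<^esub>"
  shows "a [^]\<^bsub>wreath_product K H\<^esub> (m::nat) = ((\<lambda>x\<in>carrier H. fst a x [^]\<^bsub>K\<^esub> m), \<one>\<^bsub>H\<^esub>)"
proof -
  interpret K: group K by fact
  interpret H: group H by fact
  obtain f where a: "a = (f, \<one>\<^bsub>H\<^esub>)" using assms(4) by (cases a) auto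
  have "f x \<in> carrier K" if "x \<in> carrier H" for x
    using assms(3) that by (auto simp: a carrier_wreath_product[OF assms(1)])
  then show ?thesis
    by (induction m)
      (auto simp: a one_wreath_product mult_wreath_product nat_pow_def translate_def
        intro!: restrict_ext)
qed

text \<open>The base group has finite exponent: powers are taken coordinatewise, so the exponent
  \<open>order K\<close> kills every element of it.\<close>

lemma snd_neq_one_of_infinite_order:
  assumes "group K" "group H" "finite (carrier K)"
    and "t \<in> carrier (wreath_product K H)"
    and "\<And>n::nat. 0 < n \<Longrightarrow> t [^]\<^bsub>wreath_product K H\<^esub> n \<noteq> \<one>\<^bsub>wreath_product K H\<^esub>"
  shows "snd t \<noteq> \<one>\<^bsub>H\<^esub>"
proof
  interpret K: group K by fact
  assume one: "snd t = \<one>\<^bsub>H\<^esub>"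
  have "fst t x \<in> carrier K" if "x \<in> carrier H" for x
    using assms(4) that by (auto simp: carrier_wreath_product[OF assms(1)])
  then have "t [^]\<^bsub>wreath_product K H\<^esub> order K = \<one>\<^bsub>wreath_product K H\<^esub>"
    unfolding wreath_product_base_pow[OF assms(1,2,4) one] one_wreath_product
    by (auto intro!: restrict_ext K.pow_order_eq_1)
  then show False
    using assms(5) K.order_gt_0_iff_finite assms(3) by blast
qed

text \<open>If every translate of \<open>A\<close> by a power of \<open>h\<close> met
  \<open>B\<close>, all these powers would lie in the finite set of quotients
  \<open>y \<otimes> inv x\<close> with \<open>y\<close> in \<open>B\<close> and \<open>x\<close> in
  \<open>A\<close>. Two powers would then coincide, making \<open>h\<close> torsion.\<close>

lemma (in group) exists_pow_moving_finite_set: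
  assumes "torsion_free G" "h \<in> carrier G" "h \<noteq> \<one>"
    and "finite A" "finite B" "A \<subseteq> carrier G" "B \<subseteq> carrier G"
  shows "\<exists>n::nat. \<forall>x\<in>A. h [^] n \<otimes> x \<notin> B"
proof (rule ccontr)
  assume "\<not> ?thesis"
  then have meet: "\<exists>x\<in>A. h [^] n \<otimes> x \<in> B" for n :: nat by blast
  have "h [^] n \<in> (\<lambda>(y, x). y \<otimes> inv x) ` (B \<times> A)" for n :: nat
  proof -
    obtain x where x: "x \<in> A" "h [^] n \<otimes> x \<in> B" using meet by blast
    then have "h [^] n = (h [^] n \<otimes> x) \<otimes> inv x"
      using assms(2,6) by (auto simp: m_assoc)
    with x show ?thesis by (intro image_eqI[of _ _ "(h [^] n \<otimes> x, x)"]) auto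
  qed
  then have "range (\<lambda>n::nat. h [^] n) \<subseteq> (\<lambda>(y, x). y \<otimes> inv x) ` (B \<times> A)"
    by (rule image_subsetI)
  then have "finite (range (\<lambda>n::nat. h [^] n))"
    by (rule finite_subset) (use assms(4,5) in simp)
  then have "\<not> inj (\<lambda>n::nat. h [^] n)"
    using range_inj_infinite by blast
  then obtain i j :: nat where "i < j" "h [^] i = h [^] j"
    unfolding inj_def by (metis linorder_neqE_nat)
  then have "h [^] i \<otimes> h [^] (j - i) = h [^] i"
    using nat_pow_mult[OF assms(2), of i "j - i"] by simp
  then have "h [^] (j - i) = \<one>"
    by (rule iffD1[OF l_cancel_one, rotated 2]) (rule nat_pow_closed[OF assms(2)])+
  moreover have "0 < j - i" using \<open>i < j\<close> by simp
  ultimately show False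
    using assms(1-3) unfolding torsion_free_def by blast
qed

text \<open>At each coordinate one of the two values is \<one>, so they commute even if
  \<open>K\<close> is not abelian.\<close>

lemma wreath_product_disjoint_commute:
  assumes "group K"
    and "(f, \<one>\<^bsub>H\<^esub>) \<in> carrier (wreath_product K H)" "(g, \<one>\<^bsub>H\<^esub>) \<in> carrier (wreath_product K H)"
    and "group H"
    and "\<And>x. x \<in> carrier H \<Longrightarrow> f x = \<one>\<^bsub>K\<^esub> \<or> g x = \<one>\<^bsub>K\<^esub>"
  shows "(f, \<one>\<^bsub>H\<^esub>) \<otimes>\<^bsub>wreath_product K H\<^esub> (g, \<one>\<^bsub>H\<^esub>) =
    (g, \<one>\<^bsub>H\<^esub>) \<otimes>\<^bsub>wreath_product K H\<^esub> (f, \<one>\<^bsub>H\<^esub>)"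
proof -
  interpret K: group K by fact
  interpret H: group H by fact
  have "f x \<in> carrier K" "g x \<in> carrier K" if "x \<in> carrier H" for x
    using assms(2,3) that by (auto simp: carrier_wreath_product[OF assms(1)])
  then have "f x \<otimes>\<^bsub>K\<^esub> g x = g x \<otimes>\<^bsub>K\<^esub> f x" if "x \<in> carrier H" for x
    using assms(5)[OF that] that by auto
  then show ?thesis
    by (auto simp: mult_wreath_product translate_def intro!: restrict_ext)
qed

text \<open>Both \<open>a\<close> and \<open>b\<close> lie in the base group, while \<open>t\<close>
  has a nontrivial projection \<open>h\<close> to \<open>H\<close>. Conjugation by the
  \<open>n\<close>-th power of \<open>t\<close> translates the support of \<open>a\<close> by
  \<open>h [^] n\<close>, and a suitable \<open>n\<close> makes it disjoint from the support of
  \<open>b\<close>.\<close>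

lemma wreath_product_torsion_commute:
  fixes K :: "('k, 'c) monoid_scheme" and H :: "('h, 'd) monoid_scheme"
  defines "W \<equiv> wreath_product K H"
  assumes K: "group K" "finite (carrier K)" and H: "group H" "torsion_free H"
    and carr: "t \<in> carrier W" "a \<in> carrier W" "b \<in> carrier W"
    and tors: "0 < i" "a [^]\<^bsub>W\<^esub> (i::nat) = \<one>\<^bsub>W\<^esub>" "0 < j" "b [^]\<^bsub>W\<^esub> (j::nat) = \<one>\<^bsub>W\<^esub>"
    and inf: "\<And>n::nat. 0 < n \<Longrightarrow> t [^]\<^bsub>W\<^esub> n \<noteq> \<one>\<^bsub>W\<^esub>"
  shows "\<exists>n::nat. (t [^]\<^bsub>W\<^esub> n \<otimes>\<^bsub>W\<^esub> a \<otimes>\<^bsub>W\<^esub> inv\<^bsub>W\<^esub> (t [^]\<^bsub>W\<^esub> n)) \<otimes>\<^bsub>W\<^esub> b =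
    b \<otimes>\<^bsub>W\<^esub> (t [^]\<^bsub>W\<^esub> n \<otimes>\<^bsub>W\<^esub> a \<otimes>\<^bsub>W\<^esub> inv\<^bsub>W\<^esub> (t [^]\<^bsub>W\<^esub> n))"
proof -
  interpret K: group K by fact
  interpret H: group H by fact
  interpret W: group W unfolding W_def by (rule group_wreath_product) fact+
  interpret s: group_hom W H snd
    unfolding W_def by (rule group_hom_snd_wreath_product) fact+
  note carrW = carrier_wreath_product[OF K(1), of H, folded W_def]
  note multW = mult_wreath_product[where K = K and H = H, folded W_def]
  obtain \<alpha> where a: "a = (\<alpha>, \<one>\<^bsub>H\<^esub>)"
    using snd_eq_one_of_torsion[of K H a i] K H carr(2) tors unfolding W_def by (metis prod.collapse)
  obtain \<beta> where b: "b = (\<beta>, \<one>\<^bsub>H\<^esub>)"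
    using snd_eq_one_of_torsion[of K H b j] K H carr(3) tors unfolding W_def by (metis prod.collapse)
  define h where "h = snd t"
  have h: "h \<in> carrier H" "h \<noteq> \<one>\<^bsub>H\<^esub>"
    using s.hom_closed[OF carr(1)] snd_neq_one_of_infinite_order[of K H t] K H carr(1) inf
    unfolding W_def h_def by auto
  let ?A = "{x \<in> carrier H. \<alpha> x \<noteq> \<one>\<^bsub>K\<^esub>}" and ?B = "{x \<in> carrier H. \<beta> x \<noteq> \<one>\<^bsub>K\<^esub>}"
  have "finite ?A" "finite ?B" using carr unfolding carrW a b by auto
  then obtain n :: nat where n: "h [^]\<^bsub>H\<^esub> n \<otimes>\<^bsub>H\<^esub> x \<notin> ?B" if "x \<in> ?A" for x
    using H.exists_pow_moving_finite_set[OF H(2) h, of ?A ?B] by auto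
  define u where "u = t [^]\<^bsub>W\<^esub> n"
  have u: "u \<in> carrier W" "snd u = h [^]\<^bsub>H\<^esub> n"
    using carr(1) s.hom_nat_pow[of t n] unfolding u_def h_def by auto
  obtain \<phi> where u_eq: "u = (\<phi>, h [^]\<^bsub>H\<^esub> n)" using u(2) by (metis prod.collapse)
  define s where "s = u \<otimes>\<^bsub>W\<^esub> a \<otimes>\<^bsub>W\<^esub> inv\<^bsub>W\<^esub> u"
  \<comment> \<open>The second equation replaces the definition of \<open>s\<close>, so that no
    inverse in the wreath product has to be computed coordinatewise.\<close>
  have s: "s \<in> carrier W" "s \<otimes>\<^bsub>W\<^esub> u = u \<otimes>\<^bsub>W\<^esub> a"
    using u carr unfolding s_def by (auto simp: W.m_assoc)
  have "snd s = \<one>\<^bsub>H\<^esub>"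
    using u carr h unfolding s_def by (simp add: a)
  then obtain \<sigma> where s_eq: "s = (\<sigma>, \<one>\<^bsub>H\<^esub>)" by (metis prod.collapse)
  have "s \<otimes>\<^bsub>W\<^esub> b = b \<otimes>\<^bsub>W\<^esub> s"
    unfolding s_eq b W_def
  proof (rule wreath_product_disjoint_commute)
    fix x assume x: "x \<in> carrier H"
    \<comment> \<open>\<open>y\<close> is the coordinate that translation by \<open>h [^] n\<close>
      carries to \<open>x\<close>.\<close>
    define y where "y = inv\<^bsub>H\<^esub> (h [^]\<^bsub>H\<^esub> n) \<otimes>\<^bsub>H\<^esub> x"
    have y: "y \<in> carrier H" "h [^]\<^bsub>H\<^esub> n \<otimes>\<^bsub>H\<^esub> y = x"
      using x h unfolding y_def by (auto simp: H.m_assoc[symmetric])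
    have c: "\<sigma> x \<in> carrier K" "\<phi> x \<in> carrier K"
      using s(1) u(1) x unfolding carrW s_eq u_eq by auto
    have "fst (s \<otimes>\<^bsub>W\<^esub> u) x = fst (u \<otimes>\<^bsub>W\<^esub> a) x" using s(2) by simp
    then have "\<sigma> x \<otimes>\<^bsub>K\<^esub> \<phi> x = \<phi> x \<otimes>\<^bsub>K\<^esub> \<alpha> y"
      using x unfolding s_eq u_eq a multW by (simp add: translate_def y_def)
    \<comment> \<open>\<open>\<sigma> x\<close> is the conjugate of \<open>\<alpha> y\<close> by
      \<open>\<phi> x\<close>, so it can be nontrivial only if \<open>y\<close> is in the support of
      \<open>a\<close>; the choice of \<open>n\<close> then puts \<open>x\<close> outside the
      support of \<open>b\<close>.\<close>
    then have "\<sigma> x = \<one>\<^bsub>K\<^esub>" if "\<alpha> y = \<one>\<^bsub>K\<^esub>"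
      using that c by simp
    then show "\<sigma> x = \<one>\<^bsub>K\<^esub> \<or> \<beta> x = \<one>\<^bsub>K\<^esub>"
      using n[of y] x y by auto
  qed (use s carr K H in \<open>auto simp: s_eq b W_def\<close>)
  then show ?thesis unfolding s_def u_def by blast
qed

section \<open>The group of the Cayley machine\<close>

context group
begin

abbreviation cayley_group :: "('a list \<Rightarrow> 'a list) monoid" where
  "cayley_group \<equiv> automaton_group (cayley_machine G)"

text \<open>The restriction makes this an extensional function, as required of members of
  \<open>Bij\<close>.\<close>

definition left_mult_letters :: "'a \<Rightarrow> 'a list \<Rightarrow> 'a list" where
  "left_mult_letters g = restrict (map (\<lambda>a. g \<otimes> a)) (lists (carrier G))"

lemma cayley_run_Cons:
  "mealy_run (cayley_machine G) g (a # w) = (g \<otimes> a) # mealy_run (cayley_machine G) (g \<otimes> a) w"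
  by (simp add: cayley_machine_def)

lemma mealy_alphabet_cayley_machine [simp]: "mealy_alphabet (cayley_machine G) = carrier G"
  and mealy_states_cayley_machine [simp]: "mealy_states (cayley_machine G) = carrier G"
  by (simp_all add: cayley_machine_def)

section \<open>Elements of the group as functions on words\<close>

lemma group_cayley_group: "group cayley_group"
  unfolding automaton_group_def by (intro group.group_subgroup_generated group_BijGroup)

lemma carrier_cayley_group_Bij: "carrier cayley_group \<subseteq> Bij (lists (carrier G))"
  using group.carrier_subgroup_generated_subset[OF group_BijGroup[of "lists (carrier G)"]]
  by (simp add: automaton_group_def BijGroup_def)

lemma cayley_group_app_closed:
  assumes "u \<in> carrier cayley_group" "w \<in> lists (carrier G)"
  shows "u w \<in> lists (carrier G)"
  using assms carrier_cayley_group_Bij unfolding Bij_def bij_betw_def by blast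

lemma mult_cayley_group_app:
  assumes "u \<in> carrier cayley_group" "v \<in> carrier cayley_group" "w \<in> lists (carrier G)"
  shows "(u \<otimes>\<^bsub>cayley_group\<^esub> v) w = u (v w)"
  using assms carrier_cayley_group_Bij
  by (auto simp: automaton_group_def BijGroup_def compose_def)

lemma one_cayley_group_app:
  "w \<in> lists (carrier G) \<Longrightarrow> \<one>\<^bsub>cayley_group\<^esub> w = w"
  by (simp add: automaton_group_def BijGroup_def)

lemma cayley_group_eqI:
  assumes "u \<in> carrier cayley_group" "v \<in> carrier cayley_group"
    and "\<And>w. w \<in> lists (carrier G) \<Longrightarrow> u w = v w"
  shows "u = v"
proof (rule extensionalityI)
  show "u \<in> extensional (lists (carrier G))" "v \<in> extensional (lists (carrier G))"
    using assms(1,2) carrier_cayley_group_Bij unfolding Bij_def by auto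
qed (fact assms(3))

lemma cayley_group_generator:
  "g \<in> carrier G \<Longrightarrow> mealy_function (cayley_machine G) g \<in> carrier cayley_group"
  using mealy_function_cayley_machine_Bij[of g]
  by (auto simp: automaton_group_def carrier_subgroup_generated BijGroup_def intro: generate.incl)

section \<open>Left multiplications as torsion elements\<close>

lemma cayley_run_eq_map:
  assumes "w \<in> lists (carrier G)" "g \<in> carrier G" "k \<in> carrier G"
  shows "mealy_run (cayley_machine G) (g \<otimes> k) w =
    map (\<lambda>a. g \<otimes> a) (mealy_run (cayley_machine G) k w)"
  using assms
proof (induction w arbitrary: k rule: list.induct)
  case (Cons a w)
  \<comment> \<open>The next state equals the output letter, and
    \<open>(g \<otimes> k) \<otimes> a = g \<otimes> (k \<otimes> a)\<close>; the factor
    \<open>g\<close> is thus passed on to the next state, where the induction hypothesis applies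
    with \<open>k \<otimes> a\<close>.\<close>
  then show ?case
    by (simp only: cayley_run_Cons) (auto simp: m_assoc)
qed simp

text \<open>State \<open>g\<close> computes the function of state \<one> followed by left
  multiplication by \<open>g\<close>, so this multiplication is the function of \<open>g\<close>
  times the inverse of the function of \<one>.\<close>

lemma left_mult_letters_cayley_group:
  assumes "g \<in> carrier G"
  shows "left_mult_letters g \<in> carrier cayley_group"
proof -
  interpret C: group cayley_group by (rule group_cayley_group)
  let ?x = "mealy_function (cayley_machine G) \<one>" and ?c = "mealy_function (cayley_machine G) g"
  have mem: "?x \<in> carrier cayley_group" "?c \<in> carrier cayley_group"
    using assms by (auto intro: cayley_group_generator)
  define l where "l = ?c \<otimes>\<^bsub>cayley_group\<^esub> inv\<^bsub>cayley_group\<^esub> ?x"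
  have l: "l \<in> carrier cayley_group" using mem by (simp add: l_def)
  have "left_mult_letters g w = l w" for w
  proof (cases "w \<in> lists (carrier G)")
    case True
    define v where "v = (inv\<^bsub>cayley_group\<^esub> ?x) w"
    have v: "v \<in> lists (carrier G)"
      unfolding v_def by (rule cayley_group_app_closed) (use mem True in auto)
    have "?x v = (?x \<otimes>\<^bsub>cayley_group\<^esub> inv\<^bsub>cayley_group\<^esub> ?x) w"
      using mem True by (simp only: mult_cayley_group_app C.inv_closed v_def)
    then have xv: "?x v = w"
      using mem True one_cayley_group_app by simp
    have "l w = ?c v"
      using mem True by (simp add: l_def v_def mult_cayley_group_app)
    also have "\<dots> = map (\<lambda>a. g \<otimes> a) (?x v)"
      using cayley_run_eq_map[OF v assms one_closed] v assms by (simp add: mealy_function_def)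
    finally show ?thesis
      using True xv by (simp add: left_mult_letters_def)
  next
    \<comment> \<open>Off the words over \<open>G\<close> both functions take the default value
      \<open>undefined\<close>.\<close>
    case False
    then have "l w = undefined"
      using l carrier_cayley_group_Bij unfolding Bij_def extensional_def by blast
    with False show ?thesis by (simp add: left_mult_letters_def)
  qed
  with l show ?thesis by (metis ext)
qed

lemma left_mult_letters_pow:
  assumes "g \<in> carrier G"
  shows "left_mult_letters g [^]\<^bsub>cayley_group\<^esub> (n::nat) = left_mult_letters (g [^] n)"
proof -
  interpret C: group cayley_group by (rule group_cayley_group)
  note mem = left_mult_letters_cayley_group
  show ?thesis
  proof (rule cayley_group_eqI)
    fix w assume w: "w \<in> lists (carrier G)"
    show "(left_mult_letters g [^]\<^bsub>cayley_group\<^esub> n) w = left_mult_letters (g [^] n) w"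
      using w
    proof (induction n arbitrary: w)
      case 0
      then show ?case
        by (auto simp: one_cayley_group_app left_mult_letters_def intro!: map_idI[symmetric])
    next
      case (Suc n)
      have cl: "left_mult_letters g w \<in> lists (carrier G)"
        by (rule cayley_group_app_closed[OF mem[OF assms] Suc.prems])
      then show ?case
        using Suc.IH[OF cl] Suc.prems assms mem[OF assms]
        by (simp add: mult_cayley_group_app) (auto simp: left_mult_letters_def m_assoc)
    qed
  qed (use assms mem in auto)
qed

lemma left_mult_letters_pow_order:
  assumes "g \<in> carrier G"
  shows "left_mult_letters g [^]\<^bsub>cayley_group\<^esub> order G = \<one>\<^bsub>cayley_group\<^esub>"
proof -
  interpret C: group cayley_group by (rule group_cayley_group)
  \<comment> \<open>Since \<open>g [^] order G = g [^] 0\<close>, the power formula at exponent 0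
    identifies the result with the identity.\<close>
  have "left_mult_letters g [^]\<^bsub>cayley_group\<^esub> order G = left_mult_letters (g [^] (0::nat))"
    using assms pow_order_eq_1[OF assms] by (simp add: left_mult_letters_pow)
  then show ?thesis
    using left_mult_letters_pow[OF assms, of 0] by simp
qed

section \<open>Infinite order of state \<one>\<close>

lemma cayley_run_nth_Suc:
  assumes "Suc i < length w"
  shows "mealy_run (cayley_machine G) g w ! Suc i =
    mealy_run (cayley_machine G) g w ! i \<otimes> w ! Suc i"
  using assms unfolding mealy_run_cayley_machine
  by (simp add: take_Suc_conv_app_nth[of "Suc i"])

lemma length_mealy_run [simp]: "length (mealy_run M q w) = length w"
  by (induction w arbitrary: q) auto

text \<open>
  The inverse of state \<open>1\<close> maps \<open>(b\<^sub>0, b\<^sub>1, \<dots>)\<close> to \<open>(b\<^sub>0, b\<^sub>0\<^sup>-\<^sup>1 b\<^sub>1, b\<^sub>1\<^sup>-\<^sup>1 b\<^sub>2, \<dots>)\<close>, so it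
  moves the last nontrivial letter one place to the right.
\<close>

definition last_nontrivial :: "nat \<Rightarrow> 'a list \<Rightarrow> bool" where
  "last_nontrivial d w \<longleftrightarrow>
    (d < length w \<longrightarrow> w ! d \<noteq> \<one>) \<and> (\<forall>i. d < i \<and> i < length w \<longrightarrow> w ! i = \<one>)"

text \<open>Each letter of \<open>w\<close> after the first is the quotient of two consecutive
  outputs. At \<open>Suc d\<close> the output passes from a nontrivial letter to \<one>, so the
  letter read is nontrivial; beyond it both outputs are \<one>, and so is the letter. For words
  ending before \<open>Suc d\<close> the conclusion is vacuous.\<close>

lemma last_nontrivial_cayley_run:
  assumes "w \<in> lists (carrier G)" "last_nontrivial d (mealy_function (cayley_machine G) \<one> w)"
  shows "last_nontrivial (Suc d) w"
proof -
  define v where "v = mealy_run (cayley_machine G) \<one> w"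
  have fv: "mealy_function (cayley_machine G) \<one> w = v"
    using assms(1) by (simp add: mealy_function_def v_def)
  have len: "length v = length w" by (simp add: v_def)
  have vc: "v \<in> lists (carrier G)"
    using cayley_group_app_closed[OF cayley_group_generator[OF one_closed] assms(1)] fv by simp
  have cv: "v ! i \<in> carrier G" if "i < length w" for i
    using vc that len by (auto simp: in_lists_conv_set)
  have cw: "w ! i \<in> carrier G" if "i < length w" for i
    using assms(1) that by (auto simp: in_lists_conv_set)
  have step: "v ! Suc i = v ! i \<otimes> w ! Suc i" if "Suc i < length w" for i
    using cayley_run_nth_Suc[OF that] by (simp add: v_def)
  have d: "d < length w \<longrightarrow> v ! d \<noteq> \<one>" "\<And>i. d < i \<Longrightarrow> i < length w \<Longrightarrow> v ! i = \<one>"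
    using assms(2) unfolding fv last_nontrivial_def len by auto
  have "w ! Suc d \<noteq> \<one>" if "Suc d < length w"
    using step[OF that] d(2)[of "Suc d"] d(1) cv[of d] that by (metis Suc_lessD lessI r_one)
  moreover have "w ! i = \<one>" if "Suc d < i" "i < length w" for i
  proof -
    obtain j where "i = Suc j" "d < j" using \<open>Suc d < i\<close> by (cases i) auto
    then show ?thesis
      using step[of j] d(2)[of "Suc j"] d(2)[of j] cw[of i] that by auto
  qed
  ultimately show ?thesis unfolding last_nontrivial_def by blast
qed

text \<open>If the power were trivial, the word \<open>c, \<one>, ..., \<one>\<close> would be its
  own preimage, and its last nontrivial letter would be both at position 0 and at position
  \<open>n\<close>.\<close>

lemma infinite_order_cayley_one:
  assumes "carrier G \<noteq> {\<one>}" "0 < n"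
  shows "mealy_function (cayley_machine G) \<one> [^]\<^bsub>cayley_group\<^esub> (n::nat) \<noteq> \<one>\<^bsub>cayley_group\<^esub>"
proof
  interpret C: group cayley_group by (rule group_cayley_group)
  let ?x = "mealy_function (cayley_machine G) \<one>"
  note x = cayley_group_generator[OF one_closed]
  have shift: "last_nontrivial (d + m) w"
    if "w \<in> lists (carrier G)" "last_nontrivial d ((?x [^]\<^bsub>cayley_group\<^esub> m) w)" for d m w
    using that
  proof (induction m arbitrary: w)
    case 0
    then show ?case by (simp add: one_cayley_group_app)
  next
    case (Suc m)
    have "(?x [^]\<^bsub>cayley_group\<^esub> Suc m) w = (?x [^]\<^bsub>cayley_group\<^esub> m) (?x w)"
      using x Suc.prems by (simp add: mult_cayley_group_app)
    then have "last_nontrivial (d + m) (?x w)"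
      using Suc cayley_group_app_closed[OF x] by simp
    then show ?case
      using last_nontrivial_cayley_run Suc.prems by simp
  qed
  assume one: "?x [^]\<^bsub>cayley_group\<^esub> n = \<one>\<^bsub>cayley_group\<^esub>"
  obtain c where c: "c \<in> carrier G" "c \<noteq> \<one>" using assms(1) by blast
  \<comment> \<open>The \<open>n\<close> padding letters make position \<open>n\<close> exist, so
    that \<open>last_nontrivial n ?w\<close> is not vacuous there.\<close>
  let ?w = "c # replicate n \<one>"
  have w: "?w \<in> lists (carrier G)" using c by auto
  have "last_nontrivial 0 ?w"
    using c by (auto simp: last_nontrivial_def nth_Cons')
  then have "last_nontrivial n ?w"
    using shift[OF w, of 0 n] one one_cayley_group_app[OF w] by simp
  then show False
    using assms(2) by (auto simp: last_nontrivial_def nth_Cons')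
qed

section \<open>Action on first letters\<close>

lemma cayley_one_pow_singleton:
  assumes "a \<in> carrier G"
  shows "(mealy_function (cayley_machine G) \<one> [^]\<^bsub>cayley_group\<^esub> (n::nat)) [a] = [a]"
proof -
  interpret C: group cayley_group by (rule group_cayley_group)
  have "mealy_function (cayley_machine G) \<one> [a] = [a]"
    using assms by (simp add: mealy_function_def cayley_machine_def)
  then show ?thesis
    using assms
    by (induction n) (simp_all add: one_cayley_group_app mult_cayley_group_app cayley_group_generator)
qed

text \<open>The power \<open>u\<close> fixes all one-letter words, so conjugating by it does not
  change how left multiplication by \<open>g\<close> acts on them. Evaluating both products at
  \<open>[\<one>]\<close> gives \<open>g \<otimes> k\<close> and
  \<open>k \<otimes> g\<close>.\<close>

lemma conjugates_commute_imp_commute: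
  fixes n :: nat
  defines "u \<equiv> mealy_function (cayley_machine G) \<one> [^]\<^bsub>cayley_group\<^esub> n"
  assumes g: "g \<in> carrier G" and k: "k \<in> carrier G"
    and comm: "(u \<otimes>\<^bsub>cayley_group\<^esub> left_mult_letters g \<otimes>\<^bsub>cayley_group\<^esub> inv\<^bsub>cayley_group\<^esub> u)
        \<otimes>\<^bsub>cayley_group\<^esub> left_mult_letters k =
      left_mult_letters k \<otimes>\<^bsub>cayley_group\<^esub>
        (u \<otimes>\<^bsub>cayley_group\<^esub> left_mult_letters g \<otimes>\<^bsub>cayley_group\<^esub> inv\<^bsub>cayley_group\<^esub> u)"
  shows "g \<otimes> k = k \<otimes> g"
proof -
  interpret C: group cayley_group by (rule group_cayley_group)
  note mem = left_mult_letters_cayley_group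
  have u: "u \<in> carrier cayley_group"
    unfolding u_def by (intro C.nat_pow_closed cayley_group_generator one_closed)
  define s where "s = u \<otimes>\<^bsub>cayley_group\<^esub> left_mult_letters g \<otimes>\<^bsub>cayley_group\<^esub> inv\<^bsub>cayley_group\<^esub> u"
  have s: "s \<in> carrier cayley_group" "s \<otimes>\<^bsub>cayley_group\<^esub> u = u \<otimes>\<^bsub>cayley_group\<^esub> left_mult_letters g"
    using u mem g unfolding s_def by (auto simp: C.m_assoc)
  have ua: "u [a] = [a]" if "a \<in> carrier G" for a
    unfolding u_def by (rule cayley_one_pow_singleton) fact
  have L: "left_mult_letters c [a] = [c \<otimes> a]" if "a \<in> carrier G" for a c
    using that by (simp add: left_mult_letters_def)
  have sa: "s [a] = [g \<otimes> a]" if a: "a \<in> carrier G" for a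
  proof -
    have "s (u [a]) = u (left_mult_letters g [a])"
      using mult_cayley_group_app[OF s(1) u, of "[a]"]
        mult_cayley_group_app[OF u mem[OF g], of "[a]"] s(2) a by simp
    then show ?thesis using a g by (simp add: ua L)
  qed
  have "s (left_mult_letters k [\<one>]) = left_mult_letters k (s [\<one>])"
    using comm[folded s_def] mult_cayley_group_app[OF s(1) mem[OF k], of "[\<one>]"]
      mult_cayley_group_app[OF mem[OF k] s(1), of "[\<one>]"] by simp
  then show ?thesis using g k by (simp add: L sa)
qed

end

section \<open>Commutativity of \<open>G\<close> from an embedding\<close>

theorem cayley_group_embeds_imp_commute:
  fixes G (structure)
  assumes G: "group G" "finite (carrier G)"
    and KH: "group K" "finite (carrier K)" "group H" "torsion_free H"
    and f: "f \<in> mon (automaton_group (cayley_machine G)) (wreath_product K H)"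
    and g: "g \<in> carrier G" and k: "k \<in> carrier G"
  shows "g \<otimes> k = k \<otimes> g"
proof (cases "carrier G = {\<one>}")
  \<comment> \<open>State \<one> has infinite order only when \<open>G\<close> is nontrivial; the
    trivial case is immediate.\<close>
  case False
  interpret G: group G by fact
  let ?C = "automaton_group (cayley_machine G)" and ?W = "wreath_product K H"
  let ?x = "mealy_function (cayley_machine G) \<one>" and ?L = "G.left_mult_letters"
  interpret C: group ?C by (rule G.group_cayley_group)
  interpret W: group ?W by (rule group_wreath_product) fact+
  interpret f: group_hom ?C ?W f
    using f by unfold_locales (simp add: mon_def)
  have inj: "inj_on f (carrier ?C)" using f by (simp add: mon_def)
  note L = G.left_mult_letters_cayley_group
  have x: "?x \<in> carrier ?C" by (intro G.cayley_group_generator) simp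
  have ord: "0 < order G" using G.order_gt_0_iff_finite G(2) by simp
  have tors: "f (?L c) [^]\<^bsub>?W\<^esub> order G = \<one>\<^bsub>?W\<^esub>" if "c \<in> carrier G" for c
    using f.hom_nat_pow[OF L[OF that], of "order G"] G.left_mult_letters_pow_order[OF that] by simp
  \<comment> \<open>Injectivity of \<open>f\<close> preserves infinite order.\<close>
  have inf: "f ?x [^]\<^bsub>?W\<^esub> n \<noteq> \<one>\<^bsub>?W\<^esub>" if "0 < n" for n :: nat
    using f.hom_nat_pow[OF x, of n] G.infinite_order_cayley_one[OF False that]
      inj_onD[OF inj, of "?x [^]\<^bsub>?C\<^esub> n" "\<one>\<^bsub>?C\<^esub>"] x by auto
  obtain n :: nat where n:
    "(f ?x [^]\<^bsub>?W\<^esub> n \<otimes>\<^bsub>?W\<^esub> f (?L g) \<otimes>\<^bsub>?W\<^esub> inv\<^bsub>?W\<^esub> (f ?x [^]\<^bsub>?W\<^esub> n)) \<otimes>\<^bsub>?W\<^esub> f (?L k) =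
     f (?L k) \<otimes>\<^bsub>?W\<^esub> (f ?x [^]\<^bsub>?W\<^esub> n \<otimes>\<^bsub>?W\<^esub> f (?L g) \<otimes>\<^bsub>?W\<^esub> inv\<^bsub>?W\<^esub> (f ?x [^]\<^bsub>?W\<^esub> n))"
    using wreath_product_torsion_commute[OF KH f.hom_closed[OF x] f.hom_closed[OF L[OF g]]
        f.hom_closed[OF L[OF k]] ord tors[OF g] ord tors[OF k] inf]
    by blast
  define u where "u = ?x [^]\<^bsub>?C\<^esub> n"
  have u: "u \<in> carrier ?C" using x by (simp add: u_def)
  have "f ?x [^]\<^bsub>?W\<^esub> n = f u" using f.hom_nat_pow[OF x] by (simp add: u_def)
  \<comment> \<open>Both sides of the relation in the wreath product are images under
    \<open>f\<close>, so injectivity pulls it back.\<close>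
  with n have "f ((u \<otimes>\<^bsub>?C\<^esub> ?L g \<otimes>\<^bsub>?C\<^esub> inv\<^bsub>?C\<^esub> u) \<otimes>\<^bsub>?C\<^esub> ?L k) =
      f (?L k \<otimes>\<^bsub>?C\<^esub> (u \<otimes>\<^bsub>?C\<^esub> ?L g \<otimes>\<^bsub>?C\<^esub> inv\<^bsub>?C\<^esub> u))"
    using u L[OF g] L[OF k] by simp
  then have "(u \<otimes>\<^bsub>?C\<^esub> ?L g \<otimes>\<^bsub>?C\<^esub> inv\<^bsub>?C\<^esub> u) \<otimes>\<^bsub>?C\<^esub> ?L k =
      ?L k \<otimes>\<^bsub>?C\<^esub> (u \<otimes>\<^bsub>?C\<^esub> ?L g \<otimes>\<^bsub>?C\<^esub> inv\<^bsub>?C\<^esub> u)"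
    using u L[OF g] L[OF k] by (intro inj_onD[OF inj]) auto
  then show ?thesis
    unfolding u_def by (rule G.conjugates_commute_imp_commute[OF g k])
qed (use g k in simp)

text \<open>All commutators are trivial, so every term of the lower central series after the whole
  group, which has index 0, is generated by \<one>.\<close>

lemma (in comm_group) nilpotent_class_at_most_Suc: "nilpotent_class_at_most G (Suc c)"
proof -
  have sub: "lower_central G i \<subseteq> carrier G" for i
  proof (induction i)
    case (Suc i)
    then show ?case
      unfolding lower_central.simps commutator_subgroup_def
      by (intro generate_incl) auto
  qed simp
  \<comment> \<open>This makes the set of commutators below exactly \<open>{\<one>}\<close> rather
    than empty.\<close>
  have one: "\<one> \<in> lower_central G i" for i
    by (cases i) (auto simp: commutator_subgroup_def intro: generate.one)
  have "a \<otimes> b \<otimes> inv a \<otimes> inv b = \<one>" if "a \<in> carrier G" "b \<in> carrier G" for a b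
    using that by (metis inv_mult m_assoc inv_closed m_closed r_inv)
  then have "a \<otimes> b \<otimes> inv a \<otimes> inv b = \<one>" if "a \<in> lower_central G c" "b \<in> carrier G" for a b
    using that sub[of c] by auto
  then have "{a \<otimes> b \<otimes> inv a \<otimes> inv b | a b. a \<in> lower_central G c \<and> b \<in> carrier G} = {\<one>}"
    using one[of c] one_closed by (auto intro!: exI[of _ \<one>])
  then show ?thesis
    by (simp add: nilpotent_class_at_most_def commutator_subgroup_def generate_one is_group)
qed

theorem theorem6p6:
  fixes G :: "('a, 'b) monoid_scheme"
    and K :: "('k, 'c) monoid_scheme"
    and H :: "('h, 'd) monoid_scheme"
  assumes "group G" and "finite (carrier G)"
    and "\<exists>P. finite_p_subgroup 2 P G \<and> \<not> nilpotent_class_at_most (G\<lparr>carrier := P\<rparr>) 2"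
    and "group K" and "finite (carrier K)"
    and "group H" and "torsion_free H"
  shows "\<not> (\<exists>f. f \<in> mon (automaton_group (cayley_machine G)) (wreath_product K H))"
proof
  assume "\<exists>f. f \<in> mon (automaton_group (cayley_machine G)) (wreath_product K H)"
  then obtain f where f: "f \<in> mon (automaton_group (cayley_machine G)) (wreath_product K H)" ..
  obtain P where P: "subgroup P G" "\<not> nilpotent_class_at_most (G\<lparr>carrier := P\<rparr>) 2"
    using assms(3) unfolding finite_p_subgroup_def by blast
  interpret P: group "G\<lparr>carrier := P\<rparr>"
    using P(1) assms(1) by (rule subgroup.subgroup_is_group)
  \<comment> \<open>The embedding forces any two elements of \<open>G\<close> to commute;
    \<open>P\<close> is then abelian, against its choice.\<close>
  have "comm_group (G\<lparr>carrier := P\<rparr>)"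
  proof (rule P.group_comm_groupI)
    fix x y assume "x \<in> carrier (G\<lparr>carrier := P\<rparr>)" "y \<in> carrier (G\<lparr>carrier := P\<rparr>)"
    then have "x \<in> carrier G" "y \<in> carrier G"
      using subgroup.subset[OF P(1)] by auto
    then show "x \<otimes>\<^bsub>G\<lparr>carrier := P\<rparr>\<^esub> y = y \<otimes>\<^bsub>G\<lparr>carrier := P\<rparr>\<^esub> x"
      using cayley_group_embeds_imp_commute[OF assms(1,2,4-7) f] by simp
  qed
  then show False
    using comm_group.nilpotent_class_at_most_Suc[of "G\<lparr>carrier := P\<rparr>" 1] P(2)
    by (simp add: numeral_2_eq_2)
qed

end
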